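(* Let $\mathbb{K}$ be an algebraically closed field of characteristic zero, let $B$ be a commutative $\mathbb{K}$-domain, and let $D$ be a locally nilpotent derivation on $B$. Let $m,n_1,\dots,n_m$ be positive integers with $m\ge 3$, let $a_1,\dots,a_m\in \mathrm{Ker}\, D$ be nonzero, and for $1\le i\le m$, $1\le j\le n_i$ let $k_{ij}$ be positive integers and $b_{ij}\in B$. Put $$f_i:=a_i\, b_{i1}^{k_{i1}}\cdots b_{in_i}^{k_{in_i}}\in B,\qquad i=1,\dots,m.$$ Suppose that $f_1+\dots+f_m\in \mathrm{Ker}\, D\setminus\{0\}$ and that for all $s\le m$ and all $1\le i_1<\dots<i_s\le m$, $$f_{i_1}+\dots+f_{i_s}=0\ \Longrightarrow\ f_{i_1},\dots,f_{i_s}\ \text{are pairwise relatively prime in } B.$$ Assume that $$\sum_{i=1}^{m}\sum_{j=1}^{n_i}\frac{1}{k_{ij}}\le \frac{1}{m-1}.$$ Then $b_{ij}\in \mathrm{Ker}\, D$ for all $i=1,\dots,m$ and $j=1,\dots,n_i$.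
   Context: A derivation on a commutative $\mathbb{K}$-domain $B$ is a $\mathbb{K}$-linear map $D:B\to B$ satisfying the Leibniz rule; it is locally nilpotent if for each $b\in B$ there is a non-negative integer $n$ with $D^n(b)=0$. Elements $b_1,b_2\in B$ are relatively prime in $B$ if $(b_1)\cap(b_2)=(b_1b_2)$ as ideals of $B$.
   Formalization: The conclusion for index i is claimed only if f_i is nonzero or n_i = 1: when f_i = 0 and n_i ≥ 2, one b_ij is 0 and the others are unconstrained, so the claim as stated fails (e.g. b_11 = 0, b_12 = x in K[x] with D = d/dx, f = (0,1,1)). *)

theory Defs
  imports Complex_Main "HOL-Computational_Algebra.Polynomial"
begin

text \<open>
  The domain structure of an algebra is carried by the sort \<open>idom\<close> of its type.  As the
  product is commutative, compatibility of \<open>scale\<close> with one factor suffices.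
\<close>

locale domain_algebra = vector_space scale
  for scale :: "'k::field \<Rightarrow> 'b::idom \<Rightarrow> 'b" +
  assumes scale_mult_left: "scale c x * y = scale c (x * y)"

locale algebra_derivation = domain_algebra scale
  for scale :: "'k::field \<Rightarrow> 'b::idom \<Rightarrow> 'b" +
  fixes D :: "'b \<Rightarrow> 'b"
  assumes linear_D: "Vector_Spaces.linear scale scale D"
    and leibniz: "D (x * y) = D x * y + x * D y"

locale locally_nilpotent_derivation = algebra_derivation +
  assumes locally_nilpotent: "\<exists>n. (D ^^ n) x = 0"

definition Ker :: "('b::idom \<Rightarrow> 'b) \<Rightarrow> 'b set" where
  "Ker D = {x. D x = 0}"

definition principal_ideal :: "'b::idom \<Rightarrow> 'b set" where
  "principal_ideal x = {x * y | y. True}"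

text \<open>
  Note that \<open>0\<close> is relatively prime to every element in this sense.
\<close>

definition relatively_prime :: "'b::idom \<Rightarrow> 'b \<Rightarrow> bool" where
  "relatively_prime x y \<longleftrightarrow>
     principal_ideal x \<inter> principal_ideal y = principal_ideal (x * y)"

end

theory Submission
  imports Defs "Jordan_Normal_Form.Determinant"
begin

text \<open>
  Over the constants \<open>Ker D\<close>, the nilpotency index is an additive degree, and if
  \<open>f = a * \<Prod>\<^sub>j b\<^sub>j ^ k\<^sub>j\<close> then \<open>\<Prod>\<^sub>j b\<^sub>j ^ (k\<^sub>j - t)\<close> divides \<open>f, D f, ..., D\<^sup>t f\<close>. So a Wronskian of
  the \<open>f\<^sub>i\<close> has a divisor of large degree, while a relation among the \<open>f\<^sub>i\<close> lets one replace
  a row of maximal degree and bounds the degree of the Wronskian from above: the argument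
  behind Mason's theorem, done in \<open>B\<close> itself without passing to polynomials.

  Let \<open>N\<close> index the nonconstant \<open>f\<^sub>i\<close>. The sum over \<open>N\<close> is constant. If it is nonzero, a
  shortest combination of the \<open>f\<^sub>i\<close>, \<open>i \<in> N\<close>, with nonzero constant value has
  independent terms, and the estimate above is contradictory. If it is zero, the \<open>f\<^sub>i\<close> are
  pairwise relatively prime, and a shortest linear relation among them gives the contradiction.
  So \<open>N\<close> is empty, and \<open>Ker D\<close> is factorially closed.
\<close>

section \<open>Preliminaries: permutations, divisibility and relative primality\<close>

lemma permutes_atLeast0LessThan: "p permutes {0..<n} \<Longrightarrow> i < n \<Longrightarrow> p i < (n::nat)"
  using permutes_in_image[of p "{0..<n}" i] by simp

text \<open>With \<open>x = u * u'\<close> and \<open>y = v * v'\<close>, the element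
  \<open>y * (w * u')\<close> is a common multiple of \<open>x\<close> and \<open>y\<close>, hence a
  multiple of \<open>x * y\<close>; cancelling \<open>y * u'\<close> leaves \<open>w\<close> as a
  multiple of \<open>u\<close>.\<close>

lemma relatively_prime_dvd_cancel:
  assumes rp: "relatively_prime x y" and "u dvd x" "v dvd y" "x \<noteq> 0" "y \<noteq> 0"
    and uv: "u dvd v * w"
  shows "u dvd w"
proof -
  obtain u' v' where x: "x = u * u'" and y: "y = v * v'"
    using assms by (auto elim!: dvdE)
  obtain z where z: "v * w = u * z"
    using uv by (auto elim: dvdE)
  have "y * (w * u') = (v * w) * u' * v'"
    by (simp add: y mult_ac)
  also have "\<dots> = x * (z * v')"
    unfolding z by (simp add: x mult_ac)
  finally have "y * (w * u') \<in> principal_ideal x \<inter> principal_ideal y"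
    unfolding principal_ideal_def by (metis (mono_tags, lifting) IntI mem_Collect_eq)
  then have "y * (w * u') \<in> principal_ideal (x * y)"
    using rp unfolding relatively_prime_def by blast
  then obtain q where "y * (w * u') = x * y * q"
    by (auto simp only: principal_ideal_def)
  then have "(y * u') * w = (y * u') * (u * q)"
    by (simp add: x mult_ac)
  then have "w = u * q"
    using \<open>x \<noteq> 0\<close> \<open>y \<noteq> 0\<close> x by simp
  then show ?thesis by simp
qed

text \<open>Write \<open>w = (\<Prod>i\<in>A. v i) * z\<close>. Coprimality of \<open>x\<close> with
  each \<open>y i\<close> strips the factors \<open>v i\<close> one by one, so \<open>u\<close>
  divides \<open>z\<close>.\<close>

lemma relatively_prime_mult_prod_dvd:
  assumes A: "finite A" and rp: "\<And>i. i \<in> A \<Longrightarrow> relatively_prime x (y i)"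
    and "u dvd x" "x \<noteq> 0" and v: "\<And>i. i \<in> A \<Longrightarrow> v i dvd y i" "\<And>i. i \<in> A \<Longrightarrow> y i \<noteq> 0"
    and u: "u dvd w" and prod: "(\<Prod>i\<in>A. v i) dvd w"
  shows "u * (\<Prod>i\<in>A. v i) dvd w"
proof -
  obtain z where w: "w = (\<Prod>i\<in>A. v i) * z"
    using prod by (auto elim: dvdE)
  have "u dvd (\<Prod>i\<in>B. v i) * z \<Longrightarrow> u dvd z" if "B \<subseteq> A" for B
    using finite_subset[OF that A] that
  proof (induction B rule: finite_induct)
    case (insert i B)
    then have "u dvd v i * ((\<Prod>i\<in>B. v i) * z)"
      by (simp add: mult.assoc)
    then have "u dvd (\<Prod>i\<in>B. v i) * z"
      using relatively_prime_dvd_cancel[OF rp[of i] \<open>u dvd x\<close> v(1)[of i] \<open>x \<noteq> 0\<close> v(2)[of i]]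
        insert.prems(2) by blast
    then show ?case using insert.IH insert.prems by simp
  qed simp
  then have "u dvd z" using u w by blast
  then show ?thesis by (simp add: w mult.commute[of u] mult_dvd_mono)
qed

section \<open>Derivations and their constants in characteristic zero\<close>

locale lnd_char_0 = locally_nilpotent_derivation scale D
  for scale :: "'k::field_char_0 \<Rightarrow> 'b::idom \<Rightarrow> 'b" and D :: "'b \<Rightarrow> 'b"
begin

text \<open>Characteristic zero passes from the field to \<open>'b\<close> through
  \<open>scale\<close>; it keeps binomial coefficients nonzero when degrees are added.\<close>

lemma of_nat_eq_0 [simp]: "(of_nat n :: 'b) = 0 \<longleftrightarrow> n = 0"
proof -
  have "(of_nat n :: 'b) = scale (of_nat n) 1"
    by (induction n) (simp_all add: scale_left_distrib)
  then show ?thesis by simp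
qed

lemma D_add: "D (x + y) = D x + D y"
  using linear_D by (simp add: Vector_Spaces.linear_def module_hom_def module_hom_axioms_def)

lemma D_0 [simp]: "D 0 = 0"
  using D_add[of 0 0] by (simp only: add_0_right add_cancel_right_right)

lemma D_1 [simp]: "D 1 = 0"
  using leibniz[of 1 1] by (simp only: mult_1 mult_1_right add_cancel_right_right)

lemma D_minus: "D (- x) = - D x"
  using D_add[of x "- x"] by (simp add: eq_neg_iff_add_eq_0 add.commute)

lemma D_pow_0 [simp]: "(D ^^ p) 0 = 0"
  by (induction p) simp_all

lemma D_pow_add: "(D ^^ p) (x + y) = (D ^^ p) x + (D ^^ p) y"
  by (induction p) (simp_all add: D_add)

lemma D_pow_sum: "(D ^^ p) (sum h A) = (\<Sum>i\<in>A. (D ^^ p) (h i))"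
  by (induction A rule: infinite_finite_induct) (simp_all add: D_pow_add)

lemma D_sum: "D (sum h A) = (\<Sum>i\<in>A. D (h i))"
  using D_pow_sum[of 1] by simp

lemma D_pow_eq_0_mono: "(D ^^ p) x = 0 \<Longrightarrow> p \<le> q \<Longrightarrow> (D ^^ q) x = 0"
  by (metis D_pow_0 comp_apply funpow_add le_add_diff_inverse2)

lemma Ker_0 [simp]: "0 \<in> Ker D"
  by (simp add: Ker_def)

lemma Ker_mult: "x \<in> Ker D \<Longrightarrow> y \<in> Ker D \<Longrightarrow> x * y \<in> Ker D"
  by (simp add: Ker_def leibniz)

lemma Ker_minus: "x \<in> Ker D \<Longrightarrow> - x \<in> Ker D"
  by (simp add: Ker_def D_minus)

lemma Ker_diff: "x \<in> Ker D \<Longrightarrow> y \<in> Ker D \<Longrightarrow> x - y \<in> Ker D"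
  using D_add[of x "- y"] by (simp add: Ker_def D_minus)

lemma Ker_sum: "(\<And>i. i \<in> A \<Longrightarrow> h i \<in> Ker D) \<Longrightarrow> sum h A \<in> Ker D"
  by (simp add: Ker_def D_sum)

lemma D_pow_const_mult: "c \<in> Ker D \<Longrightarrow> (D ^^ p) (c * x) = c * (D ^^ p) x"
  by (induction p) (simp_all add: leibniz Ker_def)

section \<open>The nilpotency index as a degree\<close>

text \<open>For \<open>x \<noteq> 0\<close> this is the last order of a nonvanishing derivative;
  \<open>deg 0 = 0\<close>.\<close>

definition deg :: "'b \<Rightarrow> nat" where
  "deg x = (LEAST n. (D ^^ Suc n) x = 0)"

lemma D_pow_deg_Suc: "(D ^^ Suc (deg x)) x = 0"
proof -
  obtain n where "(D ^^ n) x = 0"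
    using locally_nilpotent by blast
  then have "(D ^^ Suc n) x = 0"
    by simp
  then show ?thesis
    unfolding deg_def by (rule LeastI)
qed

lemma D_pow_eq_0: "deg x < q \<Longrightarrow> (D ^^ q) x = 0"
  using D_pow_eq_0_mono[OF D_pow_deg_Suc] by simp

lemma D_pow_deg: "x \<noteq> 0 \<Longrightarrow> (D ^^ deg x) x \<noteq> 0"
proof (cases "deg x")
  case (Suc n)
  then show ?thesis
    using not_less_Least[of n "\<lambda>n. (D ^^ Suc n) x = 0"] by (simp add: deg_def)
qed simp

lemma deg_le_iff: "x \<noteq> 0 \<Longrightarrow> deg x \<le> q \<longleftrightarrow> (D ^^ Suc q) x = 0"
  by (metis D_pow_deg D_pow_eq_0 D_pow_eq_0_mono le_imp_less_Suc not_less_eq_eq)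

lemma deg_eqI: "(D ^^ q) x \<noteq> 0 \<Longrightarrow> (D ^^ Suc q) x = 0 \<Longrightarrow> deg x = q"
  by (metis D_pow_0 D_pow_eq_0 deg_le_iff le_less linorder_not_le)

lemma deg_eq_0_iff: "deg x = 0 \<longleftrightarrow> x \<in> Ker D"
  using deg_le_iff[of x 0] D_pow_deg_Suc[of x] by (cases "x = 0") (auto simp: Ker_def deg_def intro: Least_equality)

lemma deg_const [simp]: "x \<in> Ker D \<Longrightarrow> deg x = 0"
  by (simp add: deg_eq_0_iff)

text \<open>Of the Leibniz expansion of order \<open>M + N\<close> only this term survives. The
  nested inductions split off one \<open>D\<close>, and Pascal's rule merges the two
  binomials.\<close>

lemma D_pow_mult_top:
  "(D ^^ Suc M) x = 0 \<Longrightarrow> (D ^^ Suc N) y = 0 \<Longrightarrow>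
     (D ^^ (M + N)) (x * y) = of_nat ((M + N) choose M) * ((D ^^ M) x * (D ^^ N) y)"
proof (induction M arbitrary: x N y)
  case 0
  then show ?case by (simp add: D_pow_const_mult Ker_def)
next
  case (Suc M)
  have IH: "(D ^^ (M + L)) (v * w) = of_nat ((M + L) choose M) * ((D ^^ M) v * (D ^^ L) w)"
    if "(D ^^ Suc M) v = 0" "(D ^^ Suc L) w = 0" for v w L
    using Suc.IH that by blast
  show ?case
    using Suc.prems(2)
  proof (induction N arbitrary: y)
    case 0
    then have "y \<in> Ker D" by (simp add: Ker_def)
    then show ?case by (simp add: mult.commute[of x] D_pow_const_mult del: funpow.simps)
  next
    case (Suc N)
    have 1: "(D ^^ Suc M) (D x) = 0"
      using \<open>(D ^^ Suc (Suc M)) x = 0\<close> by (simp only: funpow_Suc_right comp_apply)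
    have 2: "(D ^^ Suc N) (D y) = 0"
      using \<open>(D ^^ Suc (Suc N)) y = 0\<close> by (simp only: funpow_Suc_right comp_apply)
    have "(D ^^ (Suc M + Suc N)) (x * y) = (D ^^ (M + Suc N)) (D x * y) + (D ^^ (Suc M + N)) (x * D y)"
    proof -
      have "(D ^^ (Suc M + Suc N)) (x * y) = (D ^^ (Suc (M + N))) (D (x * y))"
        by (simp add: funpow_swap1)
      also have "\<dots> = (D ^^ (Suc (M + N))) (D x * y) + (D ^^ (Suc (M + N))) (x * D y)"
        by (simp only: leibniz D_pow_add)
      finally show ?thesis by simp
    qed
    also have "\<dots> = of_nat ((M + Suc N) choose M) * ((D ^^ M) (D x) * (D ^^ Suc N) y)
        + of_nat ((Suc M + N) choose Suc M) * ((D ^^ Suc M) x * (D ^^ N) (D y))"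
      using IH[OF 1 Suc.prems] Suc.IH[OF 2] by simp
    also have "(D ^^ M) (D x) = (D ^^ Suc M) x"
      by (simp add: funpow_Suc_right del: funpow.simps)
    also have "(D ^^ N) (D y) = (D ^^ Suc N) y"
      by (simp add: funpow_Suc_right del: funpow.simps)
    finally show ?case
      by (simp add: algebra_simps del: funpow.simps)
  qed
qed

text \<open>The product of the leading derivatives, times a nonzero binomial, is nonzero in a
  domain; it is a constant, so one further \<open>D\<close> annihilates it.\<close>

lemma deg_mult:
  assumes "x \<noteq> 0" "y \<noteq> 0"
  shows "deg (x * y) = deg x + deg y"
proof (rule deg_eqI)
  note top = D_pow_mult_top[OF D_pow_deg_Suc D_pow_deg_Suc]
  show "(D ^^ (deg x + deg y)) (x * y) \<noteq> 0"
    using assms by (simp add: top D_pow_deg)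
  have "(D ^^ deg x) x \<in> Ker D" "(D ^^ deg y) y \<in> Ker D" "of_nat j \<in> Ker D" for j
    using D_pow_deg_Suc[of x] D_pow_deg_Suc[of y] Ker_sum[of "{..<j}" "\<lambda>_. 1"]
    by (auto simp: Ker_def)
  then have "(D ^^ (deg x + deg y)) (x * y) \<in> Ker D"
    unfolding top by (intro Ker_mult)
  then show "(D ^^ Suc (deg x + deg y)) (x * y) = 0"
    by (simp add: Ker_def)
qed

lemma deg_power: "x \<noteq> 0 \<Longrightarrow> deg (x ^ q) = q * deg x"
  by (induction q) (simp_all add: deg_mult Ker_def)

lemma deg_prod: "(\<And>i. i \<in> A \<Longrightarrow> h i \<noteq> 0) \<Longrightarrow> deg (prod h A) = (\<Sum>i\<in>A. deg (h i))"
  by (induction A rule: infinite_finite_induct) (simp_all add: deg_mult Ker_def)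

lemma deg_dvd_le: "u dvd x \<Longrightarrow> x \<noteq> 0 \<Longrightarrow> deg u \<le> deg x"
  by (auto simp: deg_mult)

text \<open>The bound is an integer so that the derivative of a constant is covered: a negative bound
  forces \<open>x = 0\<close>.\<close>

definition deg_le :: "int \<Rightarrow> 'b \<Rightarrow> bool" where
  "deg_le N x \<longleftrightarrow> x = 0 \<or> int (deg x) \<le> N"

text \<open>In this form the bound is visibly stable under sums and drops by \<open>p\<close> under
  \<open>D ^^ p\<close>, also when terms vanish.\<close>

lemma deg_le_iff_D_pow: "deg_le N x \<longleftrightarrow> (\<forall>q. N < int q \<longrightarrow> (D ^^ q) x = 0)"
proof
  assume "deg_le N x"
  then show "\<forall>q. N < int q \<longrightarrow> (D ^^ q) x = 0"
    by (auto simp: deg_le_def D_pow_eq_0)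
next
  assume "\<forall>q. N < int q \<longrightarrow> (D ^^ q) x = 0"
  then show "deg_le N x"
    using D_pow_deg by (force simp: deg_le_def)
qed

lemma deg_le_deg: "deg_le (int (deg x)) x"
  by (simp add: deg_le_def)

lemma deg_le_sum: "(\<And>i. i \<in> A \<Longrightarrow> deg_le N (h i)) \<Longrightarrow> deg_le N (sum h A)"
  by (simp add: deg_le_iff_D_pow D_pow_sum)

lemma deg_le_mult: "deg_le M x \<Longrightarrow> deg_le N y \<Longrightarrow> deg_le (M + N) (x * y)"
  by (cases "x = 0 \<or> y = 0") (auto simp: deg_le_def deg_mult)

lemma deg_le_prod: "(\<And>i. i \<in> A \<Longrightarrow> deg_le (N i) (h i)) \<Longrightarrow> deg_le (sum N A) (prod h A)"
proof (induction A rule: infinite_finite_induct)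
  case (insert i A)
  then show ?case by (simp add: deg_le_mult)
qed (simp_all add: deg_le_def Ker_def)

lemma deg_le_D_pow: "deg_le N x \<Longrightarrow> deg_le (N - int p) ((D ^^ p) x)"
  unfolding deg_le_iff_D_pow
proof (intro allI impI)
  fix q assume *: "\<forall>q. N < int q \<longrightarrow> (D ^^ q) x = 0" "N - int p < int q"
  then have "(D ^^ (q + p)) x = 0" by auto
  then show "(D ^^ q) ((D ^^ p) x) = 0" by (simp add: funpow_add)
qed

section \<open>Wronskians: degree, divisors and row replacement\<close>

definition wronskian :: "nat \<Rightarrow> (nat \<Rightarrow> 'b) \<Rightarrow> 'b" where
  "wronskian s g = det (mat s s (\<lambda>(i, p). (D ^^ p) (g i)))"

lemma wronskian_expand:
  "wronskian s g = (\<Sum>p | p permutes {0..<s}. signof p * (\<Prod>i = 0..<s. (D ^^ p i) (g i)))"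
proof -
  have "wronskian s g = (\<Sum>p | p permutes {0..<s}. signof p *
      (\<Prod>i = 0..<s. mat s s (\<lambda>(i, p). (D ^^ p) (g i)) $$ (i, p i)))"
    unfolding wronskian_def by (rule det_def') simp
  also have "\<dots> = (\<Sum>p | p permutes {0..<s}. signof p * (\<Prod>i = 0..<s. (D ^^ p i) (g i)))"
    by (intro sum.cong refl arg_cong2[where f = "(*)"] prod.cong)
       (auto simp: permutes_atLeast0LessThan)
  finally show ?thesis .
qed

text \<open>Every term of the expansion has the same total order of differentiation, whatever the
  permutation, and each derivative lowers the degree bound by one.\<close>

lemma deg_le_wronskian:
  "deg_le ((\<Sum>i = 0..<s. int (deg (g i))) - (\<Sum>i = 0..<s. int i)) (wronskian s g)"
  unfolding wronskian_expand
proof (rule deg_le_sum)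
  fix p assume "p \<in> {p. p permutes {0..<s}}"
  then have p: "p permutes {0..<s}" by simp
  have "deg_le (\<Sum>i = 0..<s. int (deg (g i)) - int (p i)) (\<Prod>i = 0..<s. (D ^^ p i) (g i))"
    by (intro deg_le_prod deg_le_D_pow deg_le_deg)
  also have "(\<Sum>i = 0..<s. int (deg (g i)) - int (p i))
      = (\<Sum>i = 0..<s. int (deg (g i))) - (\<Sum>i = 0..<s. int i)"
    using sum.permute[OF p, of int] by (simp add: sum_subtractf comp_def)
  finally have "deg_le ((\<Sum>i = 0..<s. int (deg (g i))) - (\<Sum>i = 0..<s. int i))
      (\<Prod>i = 0..<s. (D ^^ p i) (g i))" .
  moreover have "deg_le 0 (signof p)"
    by (simp add: deg_le_def sign_def Ker_def D_minus)
  ultimately show "deg_le ((\<Sum>i = 0..<s. int (deg (g i))) - (\<Sum>i = 0..<s. int i))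
      (signof p * (\<Prod>i = 0..<s. (D ^^ p i) (g i)))"
    using deg_le_mult[of 0] by fastforce
qed

lemma prod_dvd_wronskian:
  assumes "\<And>i p. i < s \<Longrightarrow> p < s \<Longrightarrow> u i dvd (D ^^ p) (g i)"
  shows "(\<Prod>i = 0..<s. u i) dvd wronskian s g"
  unfolding wronskian_expand
proof (rule dvd_sum)
  fix p assume "p \<in> {p. p permutes {0..<s}}"
  then show "(\<Prod>i = 0..<s. u i) dvd signof p * (\<Prod>i = 0..<s. (D ^^ p i) (g i))"
    by (intro dvd_mult prod_dvd_prod assms) (auto simp: permutes_atLeast0LessThan)
qed

text \<open>Constants commute with all powers of \<open>D\<close>, so the new row is the same
  combination of the old rows; for \<open>l \<noteq> j\<close> two rows agree and the determinant
  vanishes.\<close>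

lemma wronskian_replace:
  assumes j: "j < s" and c: "\<And>l. l < s \<Longrightarrow> c l \<in> Ker D"
  shows "wronskian s (g(j := (\<Sum>l = 0..<s. c l * g l))) = c j * wronskian s g"
proof -
  have split: "(\<Prod>i = 0..<s. (D ^^ p i) ((g(j := x)) i))
      = (D ^^ p j) x * (\<Prod>i \<in> {0..<s} - {j}. (D ^^ p i) (g i))" for x p
    using j by (subst prod.remove[of _ j]) auto
  have "wronskian s (g(j := (\<Sum>l = 0..<s. c l * g l)))
      = (\<Sum>p | p permutes {0..<s}. \<Sum>l = 0..<s.
           signof p * (c l * ((D ^^ p j) (g l) * (\<Prod>i \<in> {0..<s} - {j}. (D ^^ p i) (g i)))))"
    unfolding wronskian_expand split D_pow_sum
    by (intro sum.cong refl)
       (simp add: sum_distrib_left sum_distrib_right D_pow_const_mult c mult.assoc)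
  also have "\<dots> = (\<Sum>l = 0..<s. c l * wronskian s (g(j := g l)))"
    unfolding wronskian_expand split
    by (subst sum.swap) (simp add: sum_distrib_left mult.left_commute)
  also have "\<dots> = (\<Sum>l = 0..<s. if l = j then c j * wronskian s g else 0)"
  proof (intro sum.cong refl)
    fix l assume l: "l \<in> {0..<s}"
    have "wronskian s (g(j := g l)) = 0" if "l \<noteq> j"
      unfolding wronskian_def
    proof (rule det_identical_rows[of _ s l j])
      show "row (mat s s (\<lambda>(i, p). (D ^^ p) ((g(j := g l)) i))) l
          = row (mat s s (\<lambda>(i, p). (D ^^ p) ((g(j := g l)) i))) j"
        using l j that by (intro eq_vecI) auto
    qed (use l j that in auto)
    then show "c l * wronskian s (g(j := g l)) = (if l = j then c j * wronskian s g else 0)"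
      by simp
  qed
  also have "\<dots> = c j * wronskian s g"
    using j by simp
  finally show ?thesis .
qed

section \<open>Vanishing Wronskians and dependence over the constants\<close>

lemma wronskian_eq_0_iff:
  "wronskian s g = 0 \<longleftrightarrow>
     (\<exists>v. (\<exists>j<s. v j \<noteq> 0) \<and> (\<forall>p<s. (\<Sum>j = 0..<s. v j * (D ^^ p) (g j)) = 0))"
  (is "_ \<longleftrightarrow> (\<exists>v. ?R v)")
proof -
  \<comment> \<open>Transposed, so that a kernel vector combines the \<open>g j\<close> and not the
    orders of differentiation.\<close>
  define M where "M = mat s s (\<lambda>(p, i). (D ^^ p) (g i))"
  have M: "M \<in> carrier_mat s s" by (simp add: M_def)
  have "wronskian s g = det (transpose_mat M)"
    unfolding wronskian_def M_def by (intro arg_cong[where f = det] eq_matI) auto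
  then have "wronskian s g = det M" using det_transpose[OF M] by simp
  then have *: "wronskian s g = 0 \<longleftrightarrow> (\<exists>v \<in> carrier_vec s. v \<noteq> 0\<^sub>v s \<and> M *\<^sub>v v = 0\<^sub>v s)"
    using det_0_iff_vec_prod_zero[OF M] by auto
  have M_eq: "M *\<^sub>v v = 0\<^sub>v s \<longleftrightarrow> (\<forall>p<s. (\<Sum>j = 0..<s. v $ j * (D ^^ p) (g j)) = 0)"
    if "v \<in> carrier_vec s" for v
  proof -
    have "(M *\<^sub>v v) $ p = (\<Sum>j = 0..<s. v $ j * (D ^^ p) (g j))" if "p < s" for p
        using that \<open>v \<in> carrier_vec s\<close> by (auto simp: M_def scalar_prod_def mult.commute)
    then show ?thesis
      using M by (auto simp: vec_eq_iff)
  qed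
  show ?thesis
    unfolding *
  proof
    assume "\<exists>v \<in> carrier_vec s. v \<noteq> 0\<^sub>v s \<and> M *\<^sub>v v = 0\<^sub>v s"
    then obtain v where "v \<in> carrier_vec s" "v \<noteq> 0\<^sub>v s" "M *\<^sub>v v = 0\<^sub>v s" by auto
    then have "\<exists>j<s. v $ j \<noteq> 0" "\<forall>p<s. (\<Sum>j = 0..<s. v $ j * (D ^^ p) (g j)) = 0"
      using M_eq[of v] by (auto simp: vec_eq_iff)
    then show "\<exists>v. ?R v" by blast
  next
    assume "\<exists>v. ?R v"
    then obtain v where v: "?R v" by blast
    then have "vec s v \<noteq> 0\<^sub>v s" by (auto simp: vec_eq_iff)
    moreover have "M *\<^sub>v vec s v = 0\<^sub>v s" using v by (simp add: M_eq)
    ultimately show "\<exists>v \<in> carrier_vec s. v \<noteq> 0\<^sub>v s \<and> M *\<^sub>v v = 0\<^sub>v s" by auto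
  qed
qed

text \<open>The hypothesis says that \<open>x / y\<close> is a constant of the fraction field; it is
  then the quotient of the leading coefficients.\<close>

lemma const_ratio:
  assumes eq: "D x * y = x * D y" and y: "y \<noteq> 0"
  shows "(D ^^ deg y) x \<in> Ker D" and "(D ^^ deg y) y * x = (D ^^ deg y) x * y"
proof -
  have pow: "(D ^^ p) x * y = x * (D ^^ p) y" for p
  proof (induction p)
    case (Suc p)
    have "D ((D ^^ p) x * y) = D (x * (D ^^ p) y)"
      using Suc by simp
    then have "(D ^^ Suc p) x * y + (D ^^ p) x * D y = D x * (D ^^ p) y + x * (D ^^ Suc p) y"
      by (simp add: leibniz)
    \<comment> \<open>Multiplying by \<open>y\<close> lets the induction hypothesis and
      \<open>eq\<close> turn the two cross terms into the same product, which then cancels.\<close>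
    then have "((D ^^ Suc p) x * y + (D ^^ p) x * D y) * y
        = (D x * (D ^^ p) y + x * (D ^^ Suc p) y) * y"
      by simp
    then have "((D ^^ Suc p) x * y) * y + ((D ^^ p) x * y) * D y
        = (D x * y) * (D ^^ p) y + (x * (D ^^ Suc p) y) * y"
      by (simp only: distrib_right distrib_left mult.assoc mult.commute mult.left_commute)
    then have "((D ^^ Suc p) x * y) * y + x * (D ^^ p) y * D y
        = (x * (D ^^ Suc p) y) * y + x * (D ^^ p) y * D y"
      unfolding eq Suc by (simp only: mult.assoc mult.commute mult.left_commute add.commute)
    then have "((D ^^ Suc p) x * y) * y = (x * (D ^^ Suc p) y) * y"
      by (simp only: add_right_cancel)
    then show ?case using y by (simp only: mult_cancel_right) simp
  qed simp
  show "(D ^^ deg y) y * x = (D ^^ deg y) x * y"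
    using pow[of "deg y"] by (simp add: mult.commute)
  show "(D ^^ deg y) x \<in> Ker D"
    using pow[of "Suc (deg y)"] D_pow_deg_Suc[of y] y by (simp add: Ker_def)
qed

text \<open>When the smaller Wronskian is nonzero, differentiating a relation \<open>v\<close>
  forces every ratio \<open>v j / v s\<close> to be constant; otherwise the induction hypothesis
  applies.\<close>

lemma wronskian_eq_0_imp_dependent:
  assumes "wronskian s g = 0"
  shows "\<exists>c. (\<forall>j<s. c j \<in> Ker D) \<and> (\<exists>j<s. c j \<noteq> 0) \<and> (\<Sum>j = 0..<s. c j * g j) = 0"
  using assms
proof (induction s)
  case 0
  then show ?case by (simp add: wronskian_def)
next
  case (Suc s)
  show ?case
  proof (cases "wronskian s g = 0")
    case True
    then obtain c where c: "\<forall>j<s. c j \<in> Ker D" "\<exists>j<s. c j \<noteq> 0" "(\<Sum>j = 0..<s. c j * g j) = 0"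
      using Suc.IH by blast
    have "(\<Sum>j = 0..<s. (c(s := 0)) j * g j) = (\<Sum>j = 0..<s. c j * g j)"
      by (intro sum.cong) auto
    then have "(\<forall>j<Suc s. (c(s := 0)) j \<in> Ker D) \<and> (\<exists>j<Suc s. (c(s := 0)) j \<noteq> 0) \<and>
        (\<Sum>j = 0..<Suc s. (c(s := 0)) j * g j) = 0"
      using c by (auto simp: less_Suc_eq)
    then show ?thesis by blast
  next
    case False
    then have indep: "\<forall>j<s. w j = 0" if "\<forall>p<s. (\<Sum>j = 0..<s. w j * (D ^^ p) (g j)) = 0" for w
      using that wronskian_eq_0_iff by blast
    obtain v where v: "\<exists>j<Suc s. v j \<noteq> 0"
      and v0: "\<And>p. p < Suc s \<Longrightarrow> (\<Sum>j = 0..<Suc s. v j * (D ^^ p) (g j)) = 0"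
      using Suc.prems wronskian_eq_0_iff by metis
    have vs: "v s \<noteq> 0"
    proof
      assume "v s = 0"
      then have "(\<Sum>j = 0..<s. v j * (D ^^ p) (g j)) = 0" if "p < s" for p
        using v0[of p] that by simp
      then have "\<forall>j<s. v j = 0" using indep by blast
      then show False using v \<open>v s = 0\<close> less_Suc_eq by auto
    qed
    \<comment> \<open>Differentiating relation \<open>p\<close> also produces relation
      \<open>p + 1\<close>, whence \<open>p < s\<close> and not \<open>p < Suc s\<close>.\<close>
    have Dv0: "(\<Sum>j = 0..<Suc s. D (v j) * (D ^^ p) (g j)) = 0" if "p < s" for p
    proof -
      have "0 = D (\<Sum>j = 0..<Suc s. v j * (D ^^ p) (g j))"
        using v0[of p] that by simp
      also have "\<dots> = (\<Sum>j = 0..<Suc s. D (v j) * (D ^^ p) (g j))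
          + (\<Sum>j = 0..<Suc s. v j * (D ^^ Suc p) (g j))"
        unfolding D_sum leibniz sum.distrib by simp
      also have "(\<Sum>j = 0..<Suc s. v j * (D ^^ Suc p) (g j)) = 0"
        using v0[of "Suc p"] that by simp
      finally show ?thesis by simp
    qed
    \<comment> \<open>The coefficients are the numerators of the derivatives of
      \<open>v j / v s\<close>; the one at \<open>j = s\<close> is zero, so the sum extends to
      \<open>Suc s\<close>.\<close>
    have "(\<Sum>j = 0..<s. (D (v j) * v s - v j * D (v s)) * (D ^^ p) (g j)) = 0" if "p < s" for p
    proof -
      have "(\<Sum>j = 0..<s. (D (v j) * v s - v j * D (v s)) * (D ^^ p) (g j))
          = (\<Sum>j = 0..<Suc s. (D (v j) * v s - v j * D (v s)) * (D ^^ p) (g j))"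
        by (simp add: mult.commute)
      also have "\<dots> = v s * (\<Sum>j = 0..<Suc s. D (v j) * (D ^^ p) (g j))
          - D (v s) * (\<Sum>j = 0..<Suc s. v j * (D ^^ p) (g j))"
        unfolding sum_distrib_left sum_subtractf[symmetric]
        by (intro sum.cong refl) (simp add: algebra_simps)
      also have "\<dots> = 0"
        using Dv0[of p] v0[of p] that by simp
      finally show ?thesis .
    qed
    then have "\<forall>j<s. D (v j) * v s - v j * D (v s) = 0"
      using indep[of "\<lambda>j. D (v j) * v s - v j * D (v s)"] by blast
    then have ratio: "D (v j) * v s = v j * D (v s)" if "j < Suc s" for j
      using that by (auto simp: less_Suc_eq mult.commute)
    \<comment> \<open>Leading coefficients clear the fractions: \<open>c j * v s = c s * v j\<close>
      with both \<open>c j\<close> and \<open>c s\<close> constant.\<close>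
    define c where "c j = (D ^^ deg (v s)) (v j)" for j
    have "c j \<in> Ker D" if "j < Suc s" for j
      unfolding c_def by (rule const_ratio(1)[OF ratio[OF that] vs])
    moreover have "c s \<noteq> 0"
      unfolding c_def by (rule D_pow_deg[OF vs])
    moreover have "(\<Sum>j = 0..<Suc s. c j * g j) = 0"
    proof -
      have "(\<Sum>j = 0..<Suc s. c j * g j) * v s = (\<Sum>j = 0..<Suc s. c s * (v j * g j))"
        unfolding sum_distrib_right
      proof (intro sum.cong refl)
        fix j assume "j \<in> {0..<Suc s}"
        then have "c s * v j = c j * v s"
          unfolding c_def by (intro const_ratio(2) ratio vs) simp
        then show "c j * g j * v s = c s * (v j * g j)"
          by (metis mult.assoc mult.commute)
      qed
      also have "\<dots> = c s * (\<Sum>j = 0..<Suc s. v j * (D ^^ 0) (g j))"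
        by (simp only: sum_distrib_left funpow_0)
      also have "\<dots> = 0" using v0[of 0] by simp
      finally show ?thesis using vs by simp
    qed
    ultimately show ?thesis by blast
  qed
qed

section \<open>Divisors of higher derivatives\<close>

text \<open>By the product rule, one derivation lowers each exponent by at most one, whichever
  factor it hits.\<close>

lemma prod_power_dvd_D:
  "(\<Prod>j\<in>A. b j ^ k j) dvd x \<Longrightarrow> (\<Prod>j\<in>A. b j ^ (k j - 1)) dvd D x"
proof (induction A arbitrary: x rule: infinite_finite_induct)
  case (insert i A)
  then have "b i ^ k i * (\<Prod>j\<in>A. b j ^ k j) dvd x"
    by simp
  then obtain y where x: "x = b i ^ k i * ((\<Prod>j\<in>A. b j ^ k j) * y)"
    by (metis dvdE mult.assoc)
  let ?P = "(\<Prod>j\<in>A. b j ^ k j) * y"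
  have pow: "b i ^ (q - 1) dvd D (b i ^ q)" for q
  proof (induction q)
    case (Suc q)
    then have "b i ^ q dvd b i * D (b i ^ q)"
      by (cases q) (auto intro: mult_dvd_mono)
    then show ?case by (simp add: leibniz)
  qed simp
  have "(\<Prod>j\<in>A. b j ^ (k j - 1)) dvd ?P"
    by (intro dvd_mult2 prod_dvd_prod le_imp_power_dvd) simp
  moreover have "(\<Prod>j\<in>A. b j ^ (k j - 1)) dvd D ?P"
    by (rule insert.IH) simp
  moreover have "b i ^ (k i - 1) dvd b i ^ k i"
    by (intro le_imp_power_dvd) simp
  ultimately show ?case
    using insert.hyps pow[of "k i"] unfolding x leibniz
    by (simp add: dvd_add mult_dvd_mono)
qed simp_all

text \<open>The lowered exponent depends on \<open>t\<close> and not on \<open>p\<close>, so that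
  one divisor serves all derivatives up to order \<open>t\<close>, as a row of the Wronskian
  requires.\<close>

lemma prod_power_dvd_D_pow:
  assumes "(\<Prod>j\<in>A. b j ^ k j) dvd x" "p \<le> t"
  shows "(\<Prod>j\<in>A. b j ^ (k j - t)) dvd (D ^^ p) x"
proof -
  have "(\<Prod>j\<in>A. b j ^ (k j - p)) dvd (D ^^ p) x"
  proof (induction p)
    case (Suc p)
    then show ?case using prod_power_dvd_D[OF Suc] by simp
  qed (use assms in simp)
  moreover have "(\<Prod>j\<in>A. b j ^ (k j - t)) dvd (\<Prod>j\<in>A. b j ^ (k j - p))"
    using assms(2) by (intro prod_dvd_prod le_imp_power_dvd) simp
  ultimately show ?thesis by (rule dvd_trans[rotated])
qed

text \<open>Only this consequence of the shape \<open>a * \<Prod>\<^sub>j b\<^sub>j ^ k\<^sub>j\<close>, with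
  \<open>r = \<Sum>\<^sub>j 1 / k\<^sub>j\<close>, enters the Wronskian estimates.\<close>

definition ramified :: "real \<Rightarrow> 'b \<Rightarrow> bool" where
  "ramified r x \<longleftrightarrow> 0 \<le> r \<and>
     (\<forall>t. \<exists>u. (\<forall>p\<le>t. u dvd (D ^^ p) x) \<and> real (deg x) * (1 - real t * r) \<le> real (deg u))"

text \<open>Lowering each exponent by \<open>t\<close> costs at most \<open>t * deg (b j)\<close>,
  and \<open>k j * deg (b j) \<le> deg x\<close> bounds this by
  \<open>t * deg x / k j\<close>.\<close>

lemma ramified_prod_power:
  assumes x: "x = a * (\<Prod>j\<in>A. b j ^ k j)" "x \<noteq> 0" and A: "finite A"
    and a: "a \<in> Ker D" and k: "\<And>j. j \<in> A \<Longrightarrow> 0 < k j"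
  shows "ramified (\<Sum>j\<in>A. 1 / real (k j)) x"
  unfolding ramified_def
proof (intro conjI allI)
  show "0 \<le> (\<Sum>j\<in>A. 1 / real (k j))"
    by (intro sum_nonneg) simp
  fix t
  have b: "b j \<noteq> 0" if "j \<in> A" for j
    using x A that k[OF that] by (auto simp: prod_zero_iff)
  have degx: "deg x = (\<Sum>j\<in>A. k j * deg (b j))"
    using x a A b by (simp add: deg_mult deg_prod deg_power)
  let ?u = "\<Prod>j\<in>A. b j ^ (k j - t)"
  have degu: "deg ?u = (\<Sum>j\<in>A. (k j - t) * deg (b j))"
    using b by (simp add: deg_prod deg_power)
  have "real (deg (b j)) \<le> real (deg x) * (1 / real (k j))" if "j \<in> A" for j
  proof -
    have "k j * deg (b j) \<le> deg x"
      unfolding degx using member_le_sum[of j A "\<lambda>j. k j * deg (b j)"] A that by simp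
    then have "real (k j) * real (deg (b j)) \<le> real (deg x)"
      by (metis of_nat_le_iff of_nat_mult)
    then show ?thesis using k[OF that] by (simp add: field_simps)
  qed
  then have "(\<Sum>j\<in>A. real (deg (b j))) \<le> real (deg x) * (\<Sum>j\<in>A. 1 / real (k j))"
    unfolding sum_distrib_left by (rule sum_mono)
  then have "real t * (\<Sum>j\<in>A. real (deg (b j))) \<le> real t * (real (deg x) * (\<Sum>j\<in>A. 1 / real (k j)))"
    by (rule mult_left_mono) simp
  moreover have "real (deg x) - real t * (\<Sum>j\<in>A. real (deg (b j))) \<le> real (deg ?u)"
  proof -
    have "real (deg x) - real t * (\<Sum>j\<in>A. real (deg (b j)))
        = (\<Sum>j\<in>A. (real (k j) - real t) * real (deg (b j)))"
      by (simp add: degx left_diff_distrib sum_subtractf sum_distrib_left)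
    \<comment> \<open>Truncated subtraction is never below the real difference.\<close>
    also have "\<dots> \<le> (\<Sum>j\<in>A. real (k j - t) * real (deg (b j)))"
      by (intro sum_mono mult_right_mono) auto
    finally show ?thesis by (simp add: degu)
  qed
  ultimately have "real (deg x) * (1 - real t * (\<Sum>j\<in>A. 1 / real (k j))) \<le> real (deg ?u)"
    by (simp add: algebra_simps)
  moreover have "\<forall>p\<le>t. ?u dvd (D ^^ p) x"
    using prod_power_dvd_D_pow[of b k A x] x by simp
  ultimately show "\<exists>u. (\<forall>p\<le>t. u dvd (D ^^ p) x) \<and>
      real (deg x) * (1 - real t * (\<Sum>j\<in>A. 1 / real (k j))) \<le> real (deg u)"
    by blast
qed

section \<open>The two degree estimates\<close>

text \<open>Replacing row \<open>j\<close> by the constant combination removes \<open>deg (g j)\<close> from the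
  degree bound of the Wronskian. The term \<open>\<Sum>l<s. l\<close> of that bound, coming from the
  orders of differentiation, settles the borderline case of the exponent condition.\<close>

lemma no_independent_const_combination:
  assumes W: "wronskian s g \<noteq> 0"
    and c: "\<And>l. l < s \<Longrightarrow> c l \<in> Ker D"
    and comb: "(\<Sum>l = 0..<s. c l * g l) \<in> Ker D"
    and j: "j < s" "c j \<noteq> 0" and top: "\<And>l. l < s \<Longrightarrow> deg (g l) \<le> deg (g j)"
    and nonconst: "g j \<notin> Ker D"
    and ram: "\<And>l. l < s \<Longrightarrow> ramified (r l) (g l)"
    and r: "real (s - 1) * (\<Sum>l = 0..<s. r l) \<le> 1"
  shows False
proof -
  let ?d = "real (deg (g j))"
  have "\<forall>l. \<exists>u. l < s \<longrightarrow> (\<forall>p\<le>s - 1. u dvd (D ^^ p) (g l)) \<and>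
      real (deg (g l)) * (1 - real (s - 1) * r l) \<le> real (deg u)"
    using ram unfolding ramified_def by blast
  then obtain u where u_dvd: "\<And>l p. l < s \<Longrightarrow> p \<le> s - 1 \<Longrightarrow> u l dvd (D ^^ p) (g l)"
    and deg_u: "\<And>l. l < s \<Longrightarrow> real (deg (g l)) * (1 - real (s - 1) * r l) \<le> real (deg (u l))"
    by metis
  have "(\<Prod>l = 0..<s. u l) dvd wronskian s g"
    by (intro prod_dvd_wronskian u_dvd) auto
  then have dvd: "(\<Prod>l = 0..<s. u l) dvd c j * wronskian s g"
    by simp
  have u0: "u l \<noteq> 0" if "l < s" for l
  proof
    assume "u l = 0"
    then have "(\<Prod>l = 0..<s. u l) = 0" using that by (auto simp: prod_zero_iff)
    with dvd W j show False by simp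
  qed
  have "(\<Sum>l = 0..<s. deg (u l)) \<le> deg (c j * wronskian s g)"
    using deg_dvd_le[OF dvd] deg_prod[of "{0..<s}" u] u0 W j by simp
  then have "(\<Sum>l = 0..<s. int (deg (u l))) \<le> int (deg (c j * wronskian s g))"
    by (simp flip: of_nat_sum)
  moreover have "int (deg (c j * wronskian s g))
      \<le> (\<Sum>l \<in> {0..<s} - {j}. int (deg (g l))) - (\<Sum>l = 0..<s. int l)"
  proof -
    \<comment> \<open>The new row is a constant by \<open>comb\<close>, so \<open>deg (g j)\<close>
      disappears from the bound.\<close>
    let ?h = "g(j := (\<Sum>l = 0..<s. c l * g l))"
    have "deg_le ((\<Sum>l = 0..<s. int (deg (?h l))) - (\<Sum>l = 0..<s. int l)) (c j * wronskian s g)"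
      using deg_le_wronskian[of ?h s] wronskian_replace[where c = c and g = g, OF j(1) c] by simp
    moreover have "(\<Sum>l = 0..<s. int (deg (?h l))) = (\<Sum>l \<in> {0..<s} - {j}. int (deg (g l)))"
      using j comb by (subst sum.remove[of _ j]) auto
    ultimately show ?thesis
      using W j by (simp add: deg_le_def)
  qed
  ultimately have "(\<Sum>l = 0..<s. int (deg (u l))) + (\<Sum>l = 0..<s. int l)
      \<le> (\<Sum>l \<in> {0..<s} - {j}. int (deg (g l)))"
    by linarith
  then have "(\<Sum>l = 0..<s. int (deg (u l))) + (\<Sum>l = 0..<s. int l) + int (deg (g j))
      \<le> (\<Sum>l = 0..<s. int (deg (g l)))"
    using j by (subst (3) sum.remove[of _ j]) auto
  then have "real_of_int ((\<Sum>l = 0..<s. int (deg (u l))) + (\<Sum>l = 0..<s. int l) + int (deg (g j)))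
      \<le> real_of_int (\<Sum>l = 0..<s. int (deg (g l)))"
    by (simp only: of_int_le_iff)
  then have upper: "(\<Sum>l = 0..<s. real (deg (u l))) + (\<Sum>l = 0..<s. real l) + ?d
      \<le> (\<Sum>l = 0..<s. real (deg (g l)))"
    by simp
  have "(\<Sum>l = 0..<s. real (deg (g l))) - real (s - 1) * (\<Sum>l = 0..<s. real (deg (g l)) * r l)
      = (\<Sum>l = 0..<s. real (deg (g l)) * (1 - real (s - 1) * r l))"
    by (simp only: right_diff_distrib mult_1_right sum_subtractf sum_distrib_left mult.left_commute)
  also have "\<dots> \<le> (\<Sum>l = 0..<s. real (deg (u l)))"
    by (intro sum_mono deg_u) simp
  finally have lower: "(\<Sum>l = 0..<s. real (deg (g l)))
      - real (s - 1) * (\<Sum>l = 0..<s. real (deg (g l)) * r l) \<le> (\<Sum>l = 0..<s. real (deg (u l)))" .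
  have "(\<Sum>l = 0..<s. real (deg (g l)) * r l) \<le> (\<Sum>l = 0..<s. ?d * r l)"
    using ram top by (intro sum_mono mult_right_mono) (auto simp: ramified_def)
  then have avg: "real (s - 1) * (\<Sum>l = 0..<s. real (deg (g l)) * r l)
      \<le> ?d * (real (s - 1) * (\<Sum>l = 0..<s. r l))"
    using mult_left_mono[of _ _ "real (s - 1)"]
    by (fastforce simp: sum_distrib_left mult.left_commute)
  have "?d * (real (s - 1) * (\<Sum>l = 0..<s. r l)) \<le> ?d"
    using mult_left_mono[OF r, of ?d] by simp
  with upper lower avg have "(\<Sum>l = 0..<s. real l) \<le> 0"
    by simp
  then have "s \<le> 1"
    using member_le_sum[of "s - 1" "{0..<s}" real] j(1) by auto
  \<comment> \<open>For \<open>s = 1\<close> the factor \<open>s - 1\<close> removes the loss term,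
    so \<open>g j\<close> itself has degree zero.\<close>
  then have "s - 1 = 0" by simp
  with upper lower have "?d \<le> 0"
    using sum_nonneg[of "{0..<s}" real] by simp
  then show False
    using nonconst deg_eq_0_iff[of "g j"] by simp
qed

text \<open>Replacing row \<open>j\<close> by \<open>c0 * x\<close> shows that the large divisor of
  \<open>x\<close> also divides the Wronskian up to a constant; coprimality combines it with the divisors
  of the rows.\<close>

lemma no_coprime_combination:
  assumes W: "wronskian s g \<noteq> 0"
    and c: "\<And>l. l < s \<Longrightarrow> c l \<in> Ker D" and c0: "c0 \<in> Ker D"
    and comb: "(\<Sum>l = 0..<s. c l * g l) = c0 * x"
    and j: "j < s" "c j \<noteq> 0" and top: "\<And>l. l < s \<Longrightarrow> deg (g l) \<le> deg x"
    and nonconst: "x \<notin> Ker D" "\<And>l. l < s \<Longrightarrow> g l \<notin> Ker D"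
    and rp: "\<And>l. l < s \<Longrightarrow> relatively_prime x (g l)"
    and ram: "ramified r0 x" "\<And>l. l < s \<Longrightarrow> ramified (r l) (g l)"
    and r: "real s * (r0 + (\<Sum>l = 0..<s. r l)) \<le> 1"
  shows False
proof -
  let ?d = "real (deg x)" and ?R = "r0 + (\<Sum>l = 0..<s. r l)"
  have x0: "x \<noteq> 0" using nonconst(1) by auto
  have g0: "g l \<noteq> 0" if "l < s" for l using nonconst(2)[OF that] by auto
  obtain u0 where u0_dvd: "\<And>p. p \<le> s - 1 \<Longrightarrow> u0 dvd (D ^^ p) x"
    and deg_u0: "?d * (1 - real (s - 1) * r0) \<le> real (deg u0)"
    using ram(1) unfolding ramified_def by blast
  have "\<forall>l. \<exists>u. l < s \<longrightarrow> (\<forall>p\<le>s - 1. u dvd (D ^^ p) (g l)) \<and>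
      real (deg (g l)) * (1 - real (s - 1) * r l) \<le> real (deg u)"
    using ram(2) unfolding ramified_def by blast
  then obtain u where u_dvd: "\<And>l p. l < s \<Longrightarrow> p \<le> s - 1 \<Longrightarrow> u l dvd (D ^^ p) (g l)"
    and deg_u: "\<And>l. l < s \<Longrightarrow> real (deg (g l)) * (1 - real (s - 1) * r l) \<le> real (deg (u l))"
    by metis
  let ?W = "c j * wronskian s g"
  have W0: "?W \<noteq> 0" using W j by simp
  have "(\<Prod>l = 0..<s. u l) dvd wronskian s g"
    by (intro prod_dvd_wronskian u_dvd) auto
  then have dvd_rows: "(\<Prod>l = 0..<s. u l) dvd ?W"
    by simp
  \<comment> \<open>The divisor family is \<open>u0\<close> in the replaced row and \<open>1\<close>
    elsewhere, giving \<open>u0\<close> alone as a divisor.\<close>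
  have "(\<Prod>l = 0..<s. if l = j then u0 else 1) dvd wronskian s (g(j := c0 * x))"
  proof (rule prod_dvd_wronskian)
    fix l p assume "l < s" "p < s"
    then show "(if l = j then u0 else 1) dvd (D ^^ p) ((g(j := c0 * x)) l)"
      using u0_dvd[of p] by (auto simp: D_pow_const_mult c0)
  qed
  then have "u0 dvd ?W"
    using j wronskian_replace[where c = c and g = g, OF j(1) c] by (simp add: comb)
  then have dvd: "u0 * (\<Prod>l = 0..<s. u l) dvd ?W"
    using u0_dvd[of 0] u_dvd[of _ 0]
    by (intro relatively_prime_mult_prod_dvd[OF _ rp _ x0 _ g0 _ dvd_rows]) auto
  then have u_nz: "u0 \<noteq> 0" "u l \<noteq> 0" if "l < s" for l
  proof -
    have "(\<Prod>l = 0..<s. u l) = 0" if "u l = 0"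
      using \<open>l < s\<close> that by (auto simp: prod_zero_iff)
    with dvd W0 show "u0 \<noteq> 0" "u l \<noteq> 0" by (metis dvd_0_left mult_zero_left mult_zero_right)+
  qed
  have u0_nz: "u0 \<noteq> 0" using u_nz(1) j by blast
  have prod_nz: "(\<Prod>l = 0..<s. u l) \<noteq> 0" using u_nz by (simp add: prod_zero_iff)
  have "deg u0 + (\<Sum>l = 0..<s. deg (u l)) \<le> deg ?W"
    using deg_dvd_le[OF dvd W0] deg_mult[OF u0_nz prod_nz] deg_prod[of "{0..<s}" u] u_nz by simp
  then have "int (deg u0) + (\<Sum>l = 0..<s. int (deg (u l))) \<le> int (deg ?W)"
    by (simp flip: of_nat_sum of_nat_add)
  moreover have "int (deg ?W) \<le> (\<Sum>l = 0..<s. int (deg (g l)))"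
    using deg_le_wronskian[of g s] W j c[OF j(1)] sum_nonneg[of "{0..<s}" int]
    by (simp add: deg_le_def deg_mult)
  ultimately have "int (deg u0) + (\<Sum>l = 0..<s. int (deg (u l))) \<le> (\<Sum>l = 0..<s. int (deg (g l)))"
    by linarith
  then have "real_of_int (int (deg u0) + (\<Sum>l = 0..<s. int (deg (u l))))
      \<le> real_of_int (\<Sum>l = 0..<s. int (deg (g l)))"
    by (simp only: of_int_le_iff)
  then have upper: "real (deg u0) + (\<Sum>l = 0..<s. real (deg (u l))) \<le> (\<Sum>l = 0..<s. real (deg (g l)))"
    by simp
  have "(\<Sum>l = 0..<s. real (deg (g l))) - real (s - 1) * (\<Sum>l = 0..<s. real (deg (g l)) * r l)
      = (\<Sum>l = 0..<s. real (deg (g l)) * (1 - real (s - 1) * r l))"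
    by (simp only: right_diff_distrib mult_1_right sum_subtractf sum_distrib_left mult.left_commute)
  also have "\<dots> \<le> (\<Sum>l = 0..<s. real (deg (u l)))"
    by (intro sum_mono deg_u) simp
  finally have lower: "(\<Sum>l = 0..<s. real (deg (g l)))
      - real (s - 1) * (\<Sum>l = 0..<s. real (deg (g l)) * r l) \<le> (\<Sum>l = 0..<s. real (deg (u l)))" .
  have "(\<Sum>l = 0..<s. real (deg (g l)) * r l) \<le> (\<Sum>l = 0..<s. ?d * r l)"
    using ram top by (intro sum_mono mult_right_mono) (auto simp: ramified_def)
  then have "real (s - 1) * (\<Sum>l = 0..<s. real (deg (g l)) * r l)
      \<le> real (s - 1) * (?d * (\<Sum>l = 0..<s. r l))"
    by (intro mult_left_mono) (simp_all add: sum_distrib_left)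
  with upper lower deg_u0 have "?d \<le> ?d * (real (s - 1) * ?R)"
    by (simp add: algebra_simps)
  moreover have "0 < ?d"
    using nonconst(1) deg_eq_0_iff[of x] by simp
  ultimately have "1 \<le> real (s - 1) * ?R"
    by (metis mult.right_neutral mult_le_cancel_left_pos)
  \<comment> \<open>The hypothesis \<open>r\<close> has the factor \<open>s\<close>, one more than
    the estimate; the two together leave no room for a positive \<open>?R\<close>.\<close>
  moreover have "real (s - 1) * ?R = real s * ?R - ?R"
    using j(1) by (simp add: of_nat_diff algebra_simps)
  ultimately have "?R \<le> 0" using r by linarith
  then have "real (s - 1) * ?R \<le> 0"
    by (intro mult_nonneg_nonpos) simp_all
  with \<open>1 \<le> real (s - 1) * ?R\<close> show False by linarith
qed

section \<open>Minimal combinations over the constants\<close>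

definition const_independent :: "('i \<Rightarrow> 'b) \<Rightarrow> 'i set \<Rightarrow> bool" where
  "const_independent f J \<longleftrightarrow>
     (\<forall>c. (\<forall>i\<in>J. c i \<in> Ker D) \<longrightarrow> (\<Sum>i\<in>J. c i * f i) = 0 \<longrightarrow> (\<forall>i\<in>J. c i = 0))"

lemma const_independent_wronskian:
  assumes "finite J" "const_independent f J"
  obtains h where "bij_betw h {0..<card J} J" "wronskian (card J) (\<lambda>l. f (h l)) \<noteq> 0"
proof -
  obtain h where h: "bij_betw h {0..<card J} J"
    using ex_bij_betw_nat_finite[OF assms(1)] by blast
  have "wronskian (card J) (\<lambda>l. f (h l)) \<noteq> 0"
  proof
    assume "wronskian (card J) (\<lambda>l. f (h l)) = 0"
    then obtain c where c: "\<forall>l<card J. c l \<in> Ker D" "\<exists>l<card J. c l \<noteq> 0"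
      "(\<Sum>l = 0..<card J. c l * f (h l)) = 0"
      using wronskian_eq_0_imp_dependent by blast
    define c' where "c' i = c (inv_into {0..<card J} h i)" for i
    have c': "c' (h l) = c l" if "l < card J" for l
      using that h by (simp add: c'_def bij_betw_def)
    have "(\<Sum>i\<in>J. c' i * f i) = (\<Sum>l = 0..<card J. c' (h l) * f (h l))"
      by (rule sum.reindex_bij_betw[OF h, symmetric])
    also have "\<dots> = 0" using c(3) c' by simp
    finally have "(\<Sum>i\<in>J. c' i * f i) = 0" .
    moreover have "c' i \<in> Ker D" if "i \<in> J" for i
    proof -
      obtain l where "l < card J" "i = h l" using \<open>i \<in> J\<close> bij_betw_imp_surj_on[OF h] by force
      then show ?thesis using c(1) c' by simp
    qed
    ultimately have "\<forall>i\<in>J. c' i = 0"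
      using assms(2) by (auto simp: const_independent_def)
    then show False
      using c(2) c' h by (metis atLeastLessThan_iff bij_betwE zero_le)
  qed
  then show thesis using h that by blast
qed

lemma obtain_deg_max:
  fixes f :: "'i \<Rightarrow> 'b"
  assumes "finite J" "J \<noteq> {}"
  obtains j where "j \<in> J" "\<And>i. i \<in> J \<Longrightarrow> deg (f i) \<le> deg (f j)"
proof -
  have "Max ((\<lambda>i. deg (f i)) ` J) \<in> (\<lambda>i. deg (f i)) ` J"
    using assms by (intro Max_in) auto
  then obtain j where "j \<in> J" "deg (f j) = Max ((\<lambda>i. deg (f i)) ` J)"
    by auto
  then show thesis using assms that[of j] by simp
qed

text \<open>Minimality of \<open>J\<close> yields both inputs of the Wronskian estimate: no
  coefficient vanishes, in particular at the term of maximal degree, and the terms are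
  independent.\<close>

lemma sum_nonconst_not_const:
  assumes N: "finite N" and nonconst: "\<And>i. i \<in> N \<Longrightarrow> f i \<notin> Ker D"
    and sum_N: "(\<Sum>i\<in>N. f i) \<in> Ker D"  "(\<Sum>i\<in>N. f i) \<noteq> 0"
    and ram: "\<And>i. i \<in> N \<Longrightarrow> ramified (r i) (f i)"
    and r: "real (card N - 1) * (\<Sum>i\<in>N. r i) \<le> 1"
  shows False
proof -
  define P where "P J \<longleftrightarrow> J \<subseteq> N \<and> (\<exists>c. (\<forall>i\<in>J. c i \<in> Ker D) \<and>
      (\<Sum>i\<in>J. c i * f i) \<in> Ker D \<and> (\<Sum>i\<in>J. c i * f i) \<noteq> 0)" for J
  have "P N"
    unfolding P_def using sum_N by (auto simp: Ker_def intro!: exI[of _ "\<lambda>_. 1"])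
  then obtain J where J: "P J" and least: "\<And>J'. P J' \<Longrightarrow> card J \<le> card J'"
    using ex_has_least_nat[of P N card] by blast
  then obtain c where JN: "J \<subseteq> N" and c: "\<And>i. i \<in> J \<Longrightarrow> c i \<in> Ker D"
    and comb: "(\<Sum>i\<in>J. c i * f i) \<in> Ker D" "(\<Sum>i\<in>J. c i * f i) \<noteq> 0"
    by (auto simp: P_def)
  have fJ: "finite J" using JN N finite_subset by blast
  \<comment> \<open>This holds for every admissible \<open>c'\<close>, so it can be applied to
    modified coefficients as well as to \<open>c\<close>.\<close>
  have minimal: "c' i \<noteq> 0" if c': "\<And>i. i \<in> J \<Longrightarrow> c' i \<in> Ker D" and "i \<in> J"
    and "(\<Sum>i\<in>J. c' i * f i) \<in> Ker D" "(\<Sum>i\<in>J. c' i * f i) \<noteq> 0" for c' i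
  proof
    assume "c' i = 0"
    then have "(\<Sum>i\<in>J. c' i * f i) = (\<Sum>i\<in>J - {i}. c' i * f i)"
      using \<open>i \<in> J\<close> fJ by (subst sum.remove[of _ i]) auto
    then have "P (J - {i})"
      using that JN unfolding P_def by (intro conjI exI[of _ c']) auto
    then show False using least[of "J - {i}"] card_Diff1_less[OF fJ \<open>i \<in> J\<close>] by simp
  qed
  have "const_independent f J"
    unfolding const_independent_def
  proof (intro allI impI ballI, rule ccontr)
    fix e i assume e: "\<forall>i\<in>J. e i \<in> Ker D" "(\<Sum>i\<in>J. e i * f i) = 0" and i: "i \<in> J" "e i \<noteq> 0"
    \<comment> \<open>This cancels the coefficient at \<open>i\<close>, while the value is only
      multiplied by the nonzero constant \<open>e i\<close>.\<close>
    let ?c' = "\<lambda>l. e i * c l - c i * e l"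
    have "(\<Sum>l\<in>J. ?c' l * f l) = e i * (\<Sum>l\<in>J. c l * f l) - c i * (\<Sum>l\<in>J. e l * f l)"
      by (simp add: left_diff_distrib sum_subtractf sum_distrib_left mult.assoc)
    then have comb': "(\<Sum>l\<in>J. ?c' l * f l) = e i * (\<Sum>l\<in>J. c l * f l)"
      using e(2) by simp
    have "?c' i \<noteq> 0"
    proof (rule minimal[of ?c' i])
      show "?c' l \<in> Ker D" if "l \<in> J" for l
        using that e(1) i(1) c by (intro Ker_diff Ker_mult) auto
      show "(\<Sum>l\<in>J. ?c' l * f l) \<in> Ker D"
        unfolding comb' using e(1) i(1) comb(1) by (intro Ker_mult) auto
      show "(\<Sum>l\<in>J. ?c' l * f l) \<noteq> 0"
        unfolding comb' using i(2) comb(2) by simp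
    qed (rule i(1))
    then show False by (simp add: mult.commute)
  qed
  then obtain h where h: "bij_betw h {0..<card J} J"
    and W: "wronskian (card J) (\<lambda>l. f (h l)) \<noteq> 0"
    using const_independent_wronskian fJ by blast
  have hJ: "h l \<in> J" "h l \<in> N" if "l < card J" for l
    using that bij_betw_apply[OF h, of l] JN by auto
  have "J \<noteq> {}" using comb by auto
  then obtain j where j: "j \<in> J" "\<And>i. i \<in> J \<Longrightarrow> deg (f i) \<le> deg (f j)"
    using obtain_deg_max fJ by blast
  then obtain l where l: "l < card J" "h l = j"
    using bij_betw_imp_surj_on[OF h] by force
  note reindex = sum.reindex_bij_betw[OF h]
  show False
  proof (rule no_independent_const_combination[OF W, where c = "\<lambda>l. c (h l)" and j = l
        and r = "\<lambda>l. r (h l)"])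
    show "(\<Sum>l = 0..<card J. c (h l) * f (h l)) \<in> Ker D"
      using comb reindex[of "\<lambda>i. c i * f i"] by simp
    show "c (h l) \<noteq> 0"
      using minimal[OF c] comb j l by simp
    have r0: "0 \<le> r i" if "i \<in> N" for i
      using ram[OF that] by (simp add: ramified_def)
    have "real (card J - 1) * (\<Sum>i\<in>J. r i) \<le> real (card N - 1) * (\<Sum>i\<in>N. r i)"
      using card_mono[OF N JN] r0 JN N
      by (intro mult_mono sum_mono2 sum_nonneg) (auto simp: diff_le_mono)
    then show "real (card J - 1) * (\<Sum>l = 0..<card J. r (h l)) \<le> 1"
      using r reindex[of r] by simp
  qed (use l j hJ c ram nonconst in auto)
qed

text \<open>In a shortest relation, the term of maximal degree is, up to a constant factor, a
  combination of the others, and those are independent.\<close>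

lemma coprime_nonconst_sum_not_0:
  assumes N: "finite N" "N \<noteq> {}" and nonconst: "\<And>i. i \<in> N \<Longrightarrow> f i \<notin> Ker D"
    and sum_N: "(\<Sum>i\<in>N. f i) = 0"
    and rp: "pairwise (\<lambda>i j. relatively_prime (f i) (f j)) N"
    and ram: "\<And>i. i \<in> N \<Longrightarrow> ramified (r i) (f i)"
    and r: "real (card N - 1) * (\<Sum>i\<in>N. r i) \<le> 1"
  shows False
proof -
  define P where "P J \<longleftrightarrow> J \<subseteq> N \<and> (\<exists>c. (\<forall>i\<in>J. c i \<in> Ker D) \<and>
      (\<exists>i\<in>J. c i \<noteq> 0) \<and> (\<Sum>i\<in>J. c i * f i) = 0)" for J
  have "P N"
    unfolding P_def using sum_N N by (auto simp: Ker_def intro!: exI[of _ "\<lambda>_. 1"])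
  then obtain J where J: "P J" and least: "\<And>J'. P J' \<Longrightarrow> card J \<le> card J'"
    using ex_has_least_nat[of P N card] by blast
  then obtain c where JN: "J \<subseteq> N" and c: "\<And>i. i \<in> J \<Longrightarrow> c i \<in> Ker D"
    and nz: "\<exists>i\<in>J. c i \<noteq> 0" and comb: "(\<Sum>i\<in>J. c i * f i) = 0"
    by (auto simp: P_def)
  have fJ: "finite J" using JN N finite_subset by blast
  have "J \<noteq> {}" using nz by auto
  then obtain i where i: "i \<in> J" and top: "\<And>l. l \<in> J \<Longrightarrow> deg (f l) \<le> deg (f i)"
    using obtain_deg_max fJ by blast
  \<comment> \<open>Removing \<open>i\<close> leaves fewer than \<open>card J\<close> terms, hence
    no relation; \<open>f i\<close> takes the role of \<open>x\<close> in the estimate.\<close>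
  define I where "I = J - {i}"
  have fI: "finite I" and IN: "I \<subseteq> N" and IJ: "I \<subseteq> J" using fJ JN by (auto simp: I_def)
  have not_P: "\<not> P I"
    using least[of I] card_Diff1_less[OF fJ i] by (auto simp: I_def)
  have indep: "const_independent f I"
    using not_P IN unfolding const_independent_def P_def by blast
  have split: "c i * f i + (\<Sum>l\<in>I. c l * f l) = 0"
    using comb i fJ unfolding I_def by (subst (asm) sum.remove[of _ i]) auto
  have ci: "c i \<noteq> 0"
  proof
    assume "c i = 0"
    then have "P I"
      using split nz c IN unfolding P_def by (intro conjI exI[of _ c]) (auto simp: I_def)
    then show False using not_P by simp
  qed
  have "f i \<noteq> 0" using nonconst[of i] i JN by auto
  \<comment> \<open>A nonzero value provides an index \<open>j\<close> with nonzero coefficient, the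
    row to be replaced.\<close>
  then have "(\<Sum>l\<in>I. c l * f l) \<noteq> 0" using split ci by auto
  then obtain j where "j \<in> I" "c j * f j \<noteq> 0"
    by (rule sum.not_neutral_contains_not_neutral)
  then have j: "j \<in> I" "c j \<noteq> 0"
    by auto
  obtain h where h: "bij_betw h {0..<card I} I"
    and W: "wronskian (card I) (\<lambda>l. f (h l)) \<noteq> 0"
    using const_independent_wronskian fI indep by blast
  have hI: "h l \<in> I" "h l \<in> J" "h l \<in> N" if "l < card I" for l
    using that bij_betw_apply[OF h, of l] IJ IN by auto
  have iN: "i \<in> N" using i JN by auto
  obtain l where l: "l < card I" "h l = j"
    using j(1) bij_betw_imp_surj_on[OF h] by force
  note reindex = sum.reindex_bij_betw[OF h]
  show False
  proof (rule no_coprime_combination[OF W, where c = "\<lambda>l. - c (h l)" and ?c0.0 = "c i"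
        and x = "f i" and j = l and ?r0.0 = "r i" and r = "\<lambda>l. r (h l)"])
    have "(\<Sum>l = 0..<card I. - c (h l) * f (h l)) = - (\<Sum>l\<in>I. c l * f l)"
      using reindex[of "\<lambda>i. - c i * f i"] by (simp add: sum_negf)
    also have "\<dots> = c i * f i"
      using split by (metis eq_neg_iff_add_eq_0)
    finally show "(\<Sum>l = 0..<card I. - c (h l) * f (h l)) = c i * f i" .
    have r0: "0 \<le> r i" if "i \<in> N" for i
      using ram[OF that] by (simp add: ramified_def)
    \<comment> \<open>\<open>I\<close> has one term fewer than \<open>J\<close>, so the factor
      \<open>s\<close> of the estimate is at most \<open>card N - 1\<close>.\<close>
    have "card I \<le> card N - 1"
      using card_mono[OF N(1) JN] i fJ by (simp add: I_def)
    moreover have "(\<Sum>l\<in>J. r l) \<le> (\<Sum>l\<in>N. r l)"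
      using r0 JN N by (intro sum_mono2) auto
    ultimately have "real (card I) * (\<Sum>l\<in>J. r l) \<le> real (card N - 1) * (\<Sum>l\<in>N. r l)"
      using r0 JN by (intro mult_mono sum_nonneg) (auto simp del: of_nat_diff)
    moreover have "(\<Sum>l\<in>J. r l) = r i + (\<Sum>l\<in>I. r l)"
      using i fJ unfolding I_def by (rule sum.remove[rotated])
    ultimately show "real (card I) * (r i + (\<Sum>l = 0..<card I. r (h l))) \<le> 1"
      using r reindex[of r] by simp
    show "relatively_prime (f i) (f (h q))" if "q < card I" for q
      using rp hI[OF that] iN unfolding I_def by (auto simp: pairwise_def)
  qed (use l j hI c i iN ram nonconst top in \<open>auto intro: Ker_minus\<close>)
qed

section \<open>From constant products to constant factors\<close>

text \<open>A divisor of a nonzero element has at most its degree, here zero.\<close>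

lemma prod_power_nonzero_const_imp_const:
  assumes x: "a * (\<Prod>j\<in>A. b j ^ k j) \<in> Ker D" "a * (\<Prod>j\<in>A. b j ^ k j) \<noteq> 0"
    and A: "finite A" "j \<in> A" and k: "0 < k j"
  shows "b j \<in> Ker D"
proof -
  have "b j dvd b j ^ k j" using k by simp
  also have "\<dots> dvd (\<Prod>j\<in>A. b j ^ k j)" using A by (rule dvd_prodI)
  finally have "b j dvd a * (\<Prod>j\<in>A. b j ^ k j)" by simp
  then have "deg (b j) \<le> 0" using deg_dvd_le x by fastforce
  then show ?thesis by (simp add: deg_eq_0_iff)
qed

end

(* The guard in the conclusion is needed: if f i = 0 then some b i j is 0, and as 0 is relatively
   prime to everything, no hypothesis constrains the other entries of that row when n i > 1. *)
theorem theorem3p3: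
  fixes scale :: "'k::{alg_closed_field, field_char_0} \<Rightarrow> 'b::idom \<Rightarrow> 'b"
    and D :: "'b \<Rightarrow> 'b"
    and m :: nat and n :: "nat \<Rightarrow> nat" and k :: "nat \<Rightarrow> nat \<Rightarrow> nat"
    and a :: "nat \<Rightarrow> 'b" and b :: "nat \<Rightarrow> nat \<Rightarrow> 'b" and f :: "nat \<Rightarrow> 'b"
  assumes lnd: "locally_nilpotent_derivation scale D"
    and m: "m \<ge> 3"
    and n: "\<And>i. i \<in> {1..m} \<Longrightarrow> n i > 0"
    and a: "\<And>i. i \<in> {1..m} \<Longrightarrow> a i \<in> Ker D - {0}"
    and k: "\<And>i j. i \<in> {1..m} \<Longrightarrow> j \<in> {1..n i} \<Longrightarrow> k i j > 0"
    and f: "\<And>i. i \<in> {1..m} \<Longrightarrow> f i = a i * (\<Prod>j=1..n i. b i j ^ k i j)"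
    and sum_f: "(\<Sum>i=1..m. f i) \<in> Ker D - {0}"
    and vanishing_subsums: "\<And>S. S \<subseteq> {1..m} \<Longrightarrow> (\<Sum>i\<in>S. f i) = 0 \<Longrightarrow>
           pairwise (\<lambda>i j. relatively_prime (f i) (f j)) S"
    and exponents: "(\<Sum>i=1..m. \<Sum>j=1..n i. 1 / real (k i j)) \<le> 1 / (real m - 1)"
  shows "\<forall>i\<in>{1..m}. (f i = 0 \<longrightarrow> n i = 1) \<longrightarrow> (\<forall>j\<in>{1..n i}. b i j \<in> Ker D)"
proof -
  interpret lnd_char_0 scale D
    using lnd by (rule lnd_char_0.intro)
  define N where "N = {i \<in> {1..m}. f i \<notin> Ker D}"
  define r where "r i = (\<Sum>j=1..n i. 1 / real (k i j))" for i
  have N: "finite N" "N \<subseteq> {1..m}" and nonconst: "\<And>i. i \<in> N \<Longrightarrow> f i \<notin> Ker D"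
    by (auto simp: N_def)
  have ram: "ramified (r i) (f i)" if "i \<in> N" for i
  proof -
    have i: "i \<in> {1..m}" using that N by auto
    have "f i \<noteq> 0" using nonconst[OF that] by auto
    then show ?thesis
      unfolding r_def using a[OF i] k[OF i] by (intro ramified_prod_power[OF f[OF i]]) auto
  qed
  have "(\<Sum>i\<in>N. r i) \<le> (\<Sum>i=1..m. r i)"
    using N by (intro sum_mono2) (auto simp: r_def intro: sum_nonneg)
  then have "(\<Sum>i\<in>N. r i) \<le> 1 / (real m - 1)"
    using exponents by (simp add: r_def)
  moreover have "real (card N - 1) \<le> real m - 1"
    using card_mono[OF _ N(2)] m by simp
  ultimately have "real (card N - 1) * (\<Sum>i\<in>N. r i) \<le> (real m - 1) * (1 / (real m - 1))"
    using m by (intro mult_mono) (auto simp: r_def intro!: sum_nonneg)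
  then have r: "real (card N - 1) * (\<Sum>i\<in>N. r i) \<le> 1"
    using m by simp
  have "(\<Sum>i=1..m. f i) = (\<Sum>i\<in>{1..m} - N. f i) + (\<Sum>i\<in>N. f i)"
    using N by (intro sum.subset_diff) auto
  moreover have "(\<Sum>i\<in>{1..m} - N. f i) \<in> Ker D"
    by (rule Ker_sum) (auto simp: N_def)
  ultimately have "(\<Sum>i\<in>N. f i) \<in> Ker D"
    using sum_f Ker_diff[of "\<Sum>i=1..m. f i" "\<Sum>i\<in>{1..m} - N. f i"] by simp
  then have "(\<Sum>i\<in>N. f i) = 0"
    using sum_nonconst_not_const[OF N(1) nonconst _ _ ram r] by blast
  \<comment> \<open>The vanishing sum over \<open>N\<close> is itself one of the subsums covered by
    the coprimality hypothesis.\<close>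
  then have "N = {}"
    using coprime_nonconst_sum_not_0[OF N(1) _ nonconst _ vanishing_subsums[OF N(2)] ram r] by blast
  then have const: "f i \<in> Ker D" if "i \<in> {1..m}" for i
    using that by (auto simp: N_def)
  show ?thesis
  proof (intro ballI impI)
    fix i j assume i: "i \<in> {1..m}" and guard: "f i = 0 \<longrightarrow> n i = 1" and j: "j \<in> {1..n i}"
    show "b i j \<in> Ker D"
    proof (cases "f i = 0")
      case True
      with guard j have "n i = 1" "j = 1" by auto
      \<comment> \<open>With a single factor and \<open>a i \<noteq> 0\<close>, a zero product makes
        \<open>b i j\<close> zero, which is a constant.\<close>
      with True f[OF i] a[OF i] have "b i j = 0" by simp
      then show ?thesis by simp
    next
      case False
      with const[OF i] show ?thesis
        unfolding f[OF i] by (rule prod_power_nonzero_const_imp_const) (use j k[OF i j] in auto)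
    qed
  qed
qed

end
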